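(* Let $C$ be a normal cone with non-empty interior $\operatorname{int} C$ in a Banach space $X$, and let $f:C\to C$ be a positively homogeneous map that preserves the partial order induced by $C$. Suppose that $f$ is uniformly continuous on every bounded subset of $C$. Then $$r_C(f)=\inf\{\lambda>0 \mid \exists u\in \operatorname{int} C,\ f(u)\le \lambda u\}.$$ If, in addition, the cone essential spectral radius of $f$ is strictly less than $r_C(f)$, i.e. $\rho_C(f)<r_C(f)$, then also $$r_C(f)=\max\{\mu\ge 0\mid \exists v\in C\setminus\{0\},\ f(v)=\mu v\},$$ where the use of $\max$ means that the set has a maximum element.
   Context: A subset $C$ of the real Banach space $X$ is a cone if $tC\subset C$ for all $t\ge 0$; it is pointed if $C\cap(-C)=\{0\}$, and proper if it is closed, convex and pointed. A proper cone induces the partial order $x\le y \iff y-x\in C$. A cone $C$ is normal if it is proper and there is a constant $M$ with $\|x\|\le M\|y\|$ whenever $0\le x\le y$. A map $f:C\to C$ is positively homogeneous if $f(tx)=tf(x)$ for all $t>0$, $x\in C$; it preserves the order if $x\le y$ implies $f(x)\le f(y)$. Cone spectral radius: $r_C(f)=\sup_{x\in C}\limsup_{k\to\infty}\|f^k(x)\|^{1/k}$, where $f^k$ is the $k$-th iterate. Fix a homogeneous generalized measure of noncompactness $\nu$ on $X$, that is, a map $\nu$ from the bounded subsets of $X$ to $[0,\infty)$ such that, for all bounded $A,B\subset X$ and scalars $\lambda$: $\nu(A)=0$ iff $\operatorname{cl}A$ is compact; $\nu(A+B)\le\nu(A)+\nu(B)$; $\nu(\operatorname{cl}\operatorname{conv}A)=\nu(A)$;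 $\nu(\lambda A)=|\lambda|\nu(A)$; $A\subset B$ implies $\nu(A)\le\nu(B)$. For $h:C\to C$ set $\nu_C(h)=\inf\{\lambda>0\mid \nu(h(A))\le\lambda\nu(A)\text{ for all bounded }A\subset C\}$. The cone essential spectral radius is $\rho_C(h)=\lim_{k\to\infty}\nu_C(h^k)^{1/k}=\inf_{k\ge1}\nu_C(h^k)^{1/k}$. *)

theory Defs
  imports "HOL-Analysis.Analysis"
begin

definition pointed :: "'a::real_vector set \<Rightarrow> bool" where
  "pointed C \<longleftrightarrow> C \<inter> uminus ` C = {0}"

definition proper_cone :: "'a::real_normed_vector set \<Rightarrow> bool" where
  "proper_cone C \<longleftrightarrow> cone C \<and> closed C \<and> convex C \<and> pointed C"

definition cone_le :: "'a::real_vector set \<Rightarrow> 'a \<Rightarrow> 'a \<Rightarrow> bool" where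
  "cone_le C x y \<longleftrightarrow> y - x \<in> C"

definition normal_cone :: "'a::real_normed_vector set \<Rightarrow> bool" where
  "normal_cone C \<longleftrightarrow> proper_cone C \<and>
     (\<exists>M. \<forall>x y. cone_le C 0 x \<and> cone_le C x y \<longrightarrow> norm x \<le> M * norm y)"

definition pos_homogeneous_on :: "'a::real_vector set \<Rightarrow> ('a \<Rightarrow> 'a) \<Rightarrow> bool" where
  "pos_homogeneous_on C f \<longleftrightarrow> (\<forall>x\<in>C. \<forall>t>0. f (t *\<^sub>R x) = t *\<^sub>R f x)"

definition order_preserving_on :: "'a::real_vector set \<Rightarrow> ('a \<Rightarrow> 'a) \<Rightarrow> bool" where
  "order_preserving_on C f \<longleftrightarrow> (\<forall>x\<in>C. \<forall>y\<in>C. cone_le C x y \<longrightarrow> cone_le C (f x) (f y))"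

text \<open>The spectral radii take values in the extended reals, so that suprema of unbounded sets
  and infima of empty sets are \<open>\<infinity>\<close>.\<close>

definition cone_spectral_radius :: "'a::real_normed_vector set \<Rightarrow> ('a \<Rightarrow> 'a) \<Rightarrow> ereal" where
  "cone_spectral_radius C f = (SUP x\<in>C. limsup (\<lambda>k. ereal (root k (norm ((f ^^ k) x)))))"

text \<open>The values of \<open>\<nu>\<close> on unbounded sets are irrelevant.\<close>

definition homogeneous_gmnc :: "('a::real_normed_vector set \<Rightarrow> real) \<Rightarrow> bool" where
  "homogeneous_gmnc \<nu> \<longleftrightarrow>
     (\<forall>A. bounded A \<longrightarrow> 0 \<le> \<nu> A) \<and>
     (\<forall>A. bounded A \<longrightarrow> (\<nu> A = 0 \<longleftrightarrow> compact (closure A))) \<and>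
     (\<forall>A B. bounded A \<longrightarrow> bounded B \<longrightarrow> \<nu> (A + B) \<le> \<nu> A + \<nu> B) \<and>
     (\<forall>A. bounded A \<longrightarrow> \<nu> (closure (convex hull A)) = \<nu> A) \<and>
     (\<forall>A c. bounded A \<longrightarrow> \<nu> ((*\<^sub>R) c ` A) = \<bar>c\<bar> * \<nu> A) \<and>
     (\<forall>A B. bounded A \<longrightarrow> bounded B \<longrightarrow> A \<subseteq> B \<longrightarrow> \<nu> A \<le> \<nu> B)"

text \<open>Since \<open>\<nu>\<close> is meaningful on bounded sets only, an admissible \<open>c\<close> also requires \<open>h\<close> to map
  bounded subsets of \<open>C\<close> to bounded sets. This is automatic for positively homogeneous maps that
  are uniformly continuous on bounded sets.\<close>

definition gmnc_bound :: "('a::real_normed_vector set \<Rightarrow> real) \<Rightarrow> 'a set \<Rightarrow> ('a \<Rightarrow> 'a) \<Rightarrow> real \<Rightarrow> bool" where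
  "gmnc_bound \<nu> C h c \<longleftrightarrow>
     (\<forall>A. A \<subseteq> C \<longrightarrow> bounded A \<longrightarrow> bounded (h ` A) \<and> \<nu> (h ` A) \<le> c * \<nu> A)"

definition cone_gmnc :: "('a::real_normed_vector set \<Rightarrow> real) \<Rightarrow> 'a set \<Rightarrow> ('a \<Rightarrow> 'a) \<Rightarrow> ereal" where
  "cone_gmnc \<nu> C h = Inf (ereal ` {c. c > 0 \<and> gmnc_bound \<nu> C h c})"

primrec ereal_root :: "nat \<Rightarrow> ereal \<Rightarrow> ereal" where
  "ereal_root k (ereal r) = ereal (root k r)"
| "ereal_root k PInfty = \<infinity>"
| "ereal_root k MInfty = -\<infinity>"

text \<open>The essential spectral radius is defined as the infimum, which makes sense even if
  \<open>cone_gmnc \<nu> C h = \<infinity>\<close>; lemma \<open>cone_ess_spectral_radius_LIMSEQ\<close> below shows that it is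
  the limit of the same sequence whenever \<open>cone_gmnc \<nu> C h < \<infinity>\<close>.\<close>

definition cone_ess_spectral_radius ::
  "('a::real_normed_vector set \<Rightarrow> real) \<Rightarrow> 'a set \<Rightarrow> ('a \<Rightarrow> 'a) \<Rightarrow> ereal" where
  "cone_ess_spectral_radius \<nu> C h = (INF k\<in>{1..}. ereal_root k (cone_gmnc \<nu> C (h ^^ k)))"

definition is_maximum :: "real set \<Rightarrow> real \<Rightarrow> bool" where
  "is_maximum S m \<longleftrightarrow> m \<in> S \<and> (\<forall>s\<in>S. s \<le> m)"

lemma cone_gmnc_less_iff:
  "cone_gmnc \<nu> C h < x \<longleftrightarrow> (\<exists>c>0. gmnc_bound \<nu> C h c \<and> ereal c < x)"
  unfolding cone_gmnc_def by (auto simp: Inf_less_iff)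

lemma cone_gmnc_le: "c > 0 \<Longrightarrow> gmnc_bound \<nu> C h c \<Longrightarrow> cone_gmnc \<nu> C h \<le> ereal c"
  unfolding cone_gmnc_def by (auto intro: Inf_lower)

lemma cone_gmnc_nonneg: "0 \<le> cone_gmnc \<nu> C h"
  unfolding cone_gmnc_def by (auto intro!: Inf_greatest)

lemma ereal_root_infty [simp]:
  "ereal_root k \<infinity> = \<infinity>" "ereal_root k (-\<infinity>) = -\<infinity>"
  using ereal_root.simps(2,3)[of k] by simp_all

lemma ereal_root_mono: "0 < k \<Longrightarrow> x \<le> y \<Longrightarrow> ereal_root k x \<le> ereal_root k y"
  by (cases x; cases y) auto

lemma gmnc_bound_comp:
  assumes "gmnc_bound \<nu> C g c" "gmnc_bound \<nu> C h d" "h ` C \<subseteq> C" "0 < c"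
  shows "gmnc_bound \<nu> C (g \<circ> h) (c * d)"
  unfolding gmnc_bound_def
proof (intro allI impI)
  fix A assume A: "A \<subseteq> C" "bounded A"
  have h: "bounded (h ` A)" "\<nu> (h ` A) \<le> d * \<nu> A" "h ` A \<subseteq> C"
    using A assms(2,3) unfolding gmnc_bound_def by (auto 0 3)
  then have "bounded (g ` h ` A)" "\<nu> (g ` h ` A) \<le> c * \<nu> (h ` A)"
    using assms(1) unfolding gmnc_bound_def by auto
  moreover have "c * \<nu> (h ` A) \<le> c * d * \<nu> A"
    using h(2) assms(4) by (simp add: mult.assoc)
  ultimately show "bounded ((g \<circ> h) ` A) \<and> \<nu> ((g \<circ> h) ` A) \<le> c * d * \<nu> A"
    unfolding image_comp by auto
qed

lemma funpow_image_subset: "h ` C \<subseteq> C \<Longrightarrow> (h ^^ n) ` C \<subseteq> C"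
  by (induction n) auto

lemma gmnc_bound_funpow:
  assumes "gmnc_bound \<nu> C h c" "h ` C \<subseteq> C" "0 < c"
  shows "gmnc_bound \<nu> C (h ^^ n) (c ^ n)"
proof (induction n)
  case 0
  then show ?case by (simp add: gmnc_bound_def)
next
  case (Suc n)
  then show ?case
    using gmnc_bound_comp[OF assms(1) Suc funpow_image_subset[OF assms(2)] assms(3)]
    by (simp add: comp_def)
qed

lemma limsup_le_cone_gmnc_root:
  assumes h: "h ` C \<subseteq> C" and fin: "cone_gmnc \<nu> C h < \<infinity>"
    and m: "0 < m" and c: "0 < c" "gmnc_bound \<nu> C (h ^^ m) c"
  shows "limsup (\<lambda>k. ereal_root k (cone_gmnc \<nu> C (h ^^ k))) \<le> ereal (root m c)"
proof -
  obtain d where d: "0 < d" "gmnc_bound \<nu> C h d"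
    using fin unfolding cone_gmnc_less_iff by blast
  define s where "s = root m c"
  have s: "0 < s" "s ^ m = c" using m c by (auto simp: s_def)
  define K where "K = max 1 (d / s) ^ m"
  have K: "0 < K" unfolding K_def by auto
  have le: "ereal_root k (cone_gmnc \<nu> C (h ^^ k)) \<le> ereal (s * root k K)" if k: "0 < k" for k
  proof -
    let ?n = "k div m" and ?j = "k mod m"
    have "h ^^ k = (h ^^ m) ^^ ?n \<circ> h ^^ ?j"
      by (metis funpow_add funpow_mult mult.commute mult_div_mod_eq)
    moreover have "gmnc_bound \<nu> C ((h ^^ m) ^^ ?n \<circ> h ^^ ?j) (c ^ ?n * d ^ ?j)"
      using c d h
      by (intro gmnc_bound_comp gmnc_bound_funpow funpow_image_subset) auto
    ultimately have "cone_gmnc \<nu> C (h ^^ k) \<le> ereal (c ^ ?n * d ^ ?j)"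
      using c d by (intro cone_gmnc_le) auto
    also have "c ^ ?n * d ^ ?j \<le> s ^ k * K"
    proof -
      have "s ^ k = c ^ ?n * s ^ ?j"
        by (metis mult_div_mod_eq power_add power_mult s(2))
      moreover have "(d / s) ^ ?j \<le> K"
      proof -
        have "(d / s) ^ ?j \<le> max 1 (d / s) ^ ?j" using d s by (intro power_mono) auto
        also have "\<dots> \<le> K" unfolding K_def using m by (intro power_increasing) auto
        finally show ?thesis .
      qed
      then have "d ^ ?j \<le> s ^ ?j * K" using s by (simp add: power_divide field_simps)
      ultimately show ?thesis using c by (simp add: mult.assoc)
    qed
    finally have "ereal_root k (cone_gmnc \<nu> C (h ^^ k)) \<le> ereal_root k (ereal (s ^ k * K))"
      using k by (intro ereal_root_mono) auto
    then show ?thesis using k s by (simp add: real_root_mult real_root_power_cancel)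
  qed
  have "(\<lambda>k. s * root k K) \<longlonglongrightarrow> s * 1"
    by (intro tendsto_mult tendsto_const LIMSEQ_root_const K)
  then have "limsup (\<lambda>k. ereal (s * root k K)) = ereal s"
    by (intro lim_imp_Limsup) auto
  moreover have "limsup (\<lambda>k. ereal_root k (cone_gmnc \<nu> C (h ^^ k))) \<le> limsup (\<lambda>k. ereal (s * root k K))"
    using le by (intro Limsup_mono) (auto simp: eventually_sequentially intro!: exI[of _ 1])
  ultimately show ?thesis by (simp add: s_def)
qed

lemma cone_ess_spectral_radius_LIMSEQ:
  assumes h: "h ` C \<subseteq> C" and fin: "cone_gmnc \<nu> C h < \<infinity>"
  shows "(\<lambda>k. ereal_root k (cone_gmnc \<nu> C (h ^^ k))) \<longlonglongrightarrow> cone_ess_spectral_radius \<nu> C h"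
proof -
  let ?a = "\<lambda>k. ereal_root k (cone_gmnc \<nu> C (h ^^ k))"
  have "cone_ess_spectral_radius \<nu> C h \<le> liminf ?a"
    unfolding cone_ess_spectral_radius_def
    by (intro Liminf_bounded) (auto simp: eventually_sequentially intro!: exI[of _ 1] INF_lower)
  moreover have "limsup ?a \<le> cone_ess_spectral_radius \<nu> C h"
    unfolding cone_ess_spectral_radius_def
  proof (rule INF_greatest)
    fix m :: nat assume "m \<in> {1..}"
    then have m: "0 < m" by auto
    show "limsup ?a \<le> ?a m"
    proof (cases "cone_gmnc \<nu> C (h ^^ m)")
      case (real r)
      have "limsup ?a \<le> ereal (root m (r + inverse (real (Suc n))))" for n
      proof -
        have "cone_gmnc \<nu> C (h ^^ m) < ereal (r + inverse (real (Suc n)))"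
          using real by simp
        then obtain c where c: "0 < c" "gmnc_bound \<nu> C (h ^^ m) c" "c < r + inverse (real (Suc n))"
          unfolding cone_gmnc_less_iff by auto
        have "limsup ?a \<le> ereal (root m c)"
          using limsup_le_cone_gmnc_root[OF h fin m c(1,2)] .
        also have "\<dots> \<le> ereal (root m (r + inverse (real (Suc n))))"
          using c m by simp
        finally show ?thesis .
      qed
      moreover have "(\<lambda>n. ereal (root m (r + inverse (real (Suc n))))) \<longlonglongrightarrow> ereal (root m (r + 0))"
        by (intro tendsto_intros LIMSEQ_inverse_real_of_nat)
      ultimately have "limsup ?a \<le> ereal (root m (r + 0))"
        by (intro LIMSEQ_le_const) blast+
      then show ?thesis using real by simp
    next
      case MInf
      then show ?thesis using cone_gmnc_nonneg[of \<nu> C "h ^^ m"] by simp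
    qed simp
  qed
  moreover have "liminf ?a \<le> limsup ?a" by (intro Liminf_le_Limsup) simp
  ultimately show ?thesis by (intro Liminf_eq_Limsup) auto
qed

end

theory Submission
  imports Defs
begin

text \<open>Fix \<open>e\<close> in the interior of \<open>C\<close> and let \<open>\<phi> x\<close> be the least \<open>t \<ge> 0\<close> with \<open>x \<le> t e\<close>. For
  \<open>\<delta> > 0\<close> the perturbation \<open>H x = f x + \<delta> \<phi>(x) e\<close> contracts Hilbert's projective metric, because
  its values are uniformly comparable to \<open>e\<close>. Iterating it gives \<open>u\<close> with \<open>\<phi> u = 1\<close> and
  \<open>\<alpha> u \<le> f u + \<delta> e \<le> (\<alpha> + \<delta>) u\<close>. The second inequality gives \<open>r\<^sub>C(f) \<le> \<alpha> + \<delta>\<close>, while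
  \<open>\<alpha>\<^sup>m \<le> \<phi>(H\<^sup>m e)\<close>, which tends to \<open>\<phi>(f\<^sup>m e)\<close> for \<open>\<delta> \<rightarrow> 0\<close>, gives \<open>\<alpha> \<rightarrow> r\<^sub>C(f)\<close>; this is the first
  formula. Moreover \<open>f u - r u \<rightarrow> 0\<close> for \<open>r = r\<^sub>C(f)\<close> and \<open>\<delta> \<rightarrow> 0\<close>, hence \<open>f\<^sup>k u - r\<^sup>k u \<rightarrow> 0\<close> for every \<open>k\<close>. If
  \<open>\<nu>\<^sub>C(f\<^sup>k) < r\<^sup>k\<close> for some \<open>k\<close>, the set of these \<open>u\<close> therefore has measure of noncompactness \<open>0\<close>,
  and any accumulation point is an eigenvector for \<open>r\<close>.\<close>

section \<open>Order and norm in a normal cone\<close>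

locale ordered_cone =
  fixes C :: "'a::real_normed_vector set"
  assumes normal: "normal_cone C"
begin

abbreviation le (infix "\<preceq>" 50) where "x \<preceq> y \<equiv> cone_le C x y"

lemma cone_C: "cone C" and closed_C: "closed C" and convex_C: "convex C" and pointed_C: "pointed C"
  using normal by (auto simp: normal_cone_def proper_cone_def)

lemma zero_mem: "0 \<in> C"
  using pointed_C by (auto simp: pointed_def)

lemma scale_mem: "x \<in> C \<Longrightarrow> 0 \<le> t \<Longrightarrow> t *\<^sub>R x \<in> C"
  using cone_C by (auto simp: cone_def)

lemma add_mem: "x \<in> C \<Longrightarrow> y \<in> C \<Longrightarrow> x + y \<in> C"
  using convex_cone[of C] cone_C convex_C by auto

lemma mem_uminus_eq_0: "x \<in> C \<Longrightarrow> - x \<in> C \<Longrightarrow> x = 0"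
  using pointed_C unfolding pointed_def by (metis IntI image_eqI minus_minus singletonD)

lemma ord_refl: "x \<preceq> x"
  using zero_mem by (simp add: cone_le_def)

lemma ord_trans [trans]: "x \<preceq> y \<Longrightarrow> y \<preceq> z \<Longrightarrow> x \<preceq> z"
  using add_mem[of "y - x" "z - y"] by (simp add: cone_le_def)

lemma le_add_mono: "x \<preceq> y \<Longrightarrow> a \<preceq> b \<Longrightarrow> x + a \<preceq> y + b"
  using add_mem[of "y - x" "b - a"] by (simp add: cone_le_def algebra_simps)

lemma le_scale: "x \<preceq> y \<Longrightarrow> 0 \<le> t \<Longrightarrow> t *\<^sub>R x \<preceq> t *\<^sub>R y"
  using scale_mem[of "y - x" t] by (simp add: cone_le_def algebra_simps)

lemma scale_le_scale: "x \<in> C \<Longrightarrow> s \<le> t \<Longrightarrow> s *\<^sub>R x \<preceq> t *\<^sub>R x"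
  using scale_mem[of x "t - s"] by (simp add: cone_le_def algebra_simps)

lemma zero_le_iff: "0 \<preceq> x \<longleftrightarrow> x \<in> C"
  by (simp add: cone_le_def)

lemma le_mem: "x \<in> C \<Longrightarrow> x \<preceq> y \<Longrightarrow> y \<in> C"
  using ord_trans[of 0 x y] by (simp add: zero_le_iff)

lemma normal_bound:
  obtains M where "0 < M" "\<And>x y. x \<in> C \<Longrightarrow> x \<preceq> y \<Longrightarrow> norm x \<le> M * norm y"
proof -
  obtain M where M: "\<And>x y. x \<in> C \<Longrightarrow> x \<preceq> y \<Longrightarrow> norm x \<le> M * norm y"
    using normal by (auto simp: normal_cone_def zero_le_iff)
  have "norm x \<le> max M 1 * norm y" if "x \<in> C" "x \<preceq> y" for x y
    by (rule order_trans[OF M[OF that]]) (simp add: mult_right_mono)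
  then show thesis by (intro that[of "max M 1"]) auto
qed

text \<open>If the ball of radius \<open>r\<close> around \<open>e\<close> lies in \<open>C\<close>,
  then \<open>e - (r / norm x) *\<^sub>R x\<close> is in \<open>C\<close>, and rescaling gives
  \<open>L = 1 / r\<close>. Here \<open>x\<close> ranges over the whole space.\<close>

lemma interior_dominates:
  assumes "e \<in> interior C"
  obtains L where "0 < L" "\<And>x. x \<preceq> (L * norm x) *\<^sub>R e"
proof -
  obtain r where r: "0 < r" "cball e r \<subseteq> C"
    using assms by (auto simp: mem_interior_cball)
  have "x \<preceq> (inverse r * norm x) *\<^sub>R e" for x
  proof (cases "x = 0")
    case False
    have "e - (r / norm x) *\<^sub>R x \<in> C"
      using r False by (intro subsetD[OF r(2)]) (simp add: dist_norm)
    then have "(inverse r * norm x) *\<^sub>R (e - (r / norm x) *\<^sub>R x) \<in> C"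
      using r by (intro scale_mem) auto
    then show ?thesis using r False by (simp add: cone_le_def scaleR_diff_right)
  qed (simp add: ord_refl)
  then show thesis using r by (intro that[of "inverse r"]) auto
qed

text \<open>The ball of radius \<open>t * r\<close> around \<open>x\<close> is
  \<open>x - t *\<^sub>R e\<close> plus \<open>t\<close> times the ball of radius \<open>r\<close>
  around \<open>e\<close>: a sum of elements of \<open>C\<close>.\<close>

lemma interior_upward:
  assumes "e \<in> interior C" "0 < t" "t *\<^sub>R e \<preceq> x"
  shows "x \<in> interior C"
proof -
  obtain r where r: "0 < r" "ball e r \<subseteq> C"
    using assms by (auto simp: mem_interior)
  have "ball x (t * r) \<subseteq> C"
  proof
    fix y assume "y \<in> ball x (t * r)"
    moreover have "e + inverse t *\<^sub>R (y - x) \<in> ball e r"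
      if "norm (y - x) < t * r"
    proof -
      have "norm (inverse t *\<^sub>R (y - x)) < r"
        using that assms(2) by (simp add: divide_simps mult.commute)
      then show ?thesis by (simp add: dist_norm)
    qed
    ultimately have "e + inverse t *\<^sub>R (y - x) \<in> C"
      using r by (auto simp: dist_norm norm_minus_commute)
    then have "t *\<^sub>R (e + inverse t *\<^sub>R (y - x)) \<in> C"
      using assms(2) by (intro scale_mem) auto
    then have "t *\<^sub>R e + (y - x) \<in> C"
      using assms(2) by (simp add: scaleR_add_right)
    from add_mem[OF this] show "y \<in> C"
      using assms(3) unfolding cone_le_def by fastforce
  qed
  then show ?thesis using r assms(2) unfolding mem_interior by (intro exI[of _ "t * r"]) auto
qed

end

section \<open>The gauge of an interior point\<close>

locale cone_with_unit = ordered_cone +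
  fixes e :: 'a
  assumes unit: "e \<in> interior C" "e \<noteq> 0"
begin

text \<open>The \<phi> of the overview. Demanding \<open>0 \<le> t\<close> bounds the set below, so
  the gauge vanishes on \<open>- C\<close>.\<close>

definition unit_gauge :: "'a \<Rightarrow> real" where
  "unit_gauge x = Inf {t. 0 \<le> t \<and> x \<preceq> t *\<^sub>R e}"

lemma unit_mem: "e \<in> C"
  using unit interior_subset by auto

text \<open>Admissible \<open>t\<close> exist by \<open>interior_dominates\<close> and form a closed
  set because \<open>C\<close> is closed, so the infimum is attained.\<close>

lemma unit_gauge_nonneg: "0 \<le> unit_gauge x"
  and unit_gauge_le: "0 \<le> t \<Longrightarrow> x \<preceq> t *\<^sub>R e \<Longrightarrow> unit_gauge x \<le> t"
  and le_unit_gauge: "x \<preceq> unit_gauge x *\<^sub>R e"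
proof -
  let ?S = "{t. 0 \<le> t \<and> x \<preceq> t *\<^sub>R e}"
  obtain L where "0 < L" "\<And>x. x \<preceq> (L * norm x) *\<^sub>R e"
    using interior_dominates[OF unit(1)] by blast
  then have ne: "?S \<noteq> {}" by (auto intro!: exI[of _ "L * norm x"])
  have bdd: "bdd_below ?S" by (auto intro!: bdd_belowI[of _ 0])
  show "0 \<le> unit_gauge x" unfolding unit_gauge_def by (intro cInf_greatest ne) auto
  show "unit_gauge x \<le> t" if "0 \<le> t" "x \<preceq> t *\<^sub>R e"
    unfolding unit_gauge_def using that by (intro cInf_lower bdd) auto
  have "?S = {0..} \<inter> (\<lambda>t. t *\<^sub>R e - x) -` C" by (auto simp: cone_le_def)
  moreover have "closed \<dots>"
    by (intro closed_Int closed_vimage closed_C continuous_intros)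
  ultimately have "Inf ?S \<in> ?S"
    by (intro closed_contains_Inf ne bdd) simp
  then show "x \<preceq> unit_gauge x *\<^sub>R e" unfolding unit_gauge_def by auto
qed

lemma unit_gauge_mono: "x \<preceq> y \<Longrightarrow> unit_gauge x \<le> unit_gauge y"
  by (intro unit_gauge_le unit_gauge_nonneg ord_trans[OF _ le_unit_gauge])

lemma unit_gauge_scale:
  assumes "0 \<le> t" shows "unit_gauge (t *\<^sub>R x) = t * unit_gauge x"
proof -
  have le: "unit_gauge (t *\<^sub>R x) \<le> t * unit_gauge x" if "0 \<le> t" for t x
    using le_scale[OF le_unit_gauge that] that unit_gauge_nonneg by (intro unit_gauge_le) auto
  show ?thesis
  proof (cases "t = 0")
    case False
    \<comment> \<open>The reverse inequality is the same bound for the scalar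
      \<open>inverse t\<close> and the vector \<open>t *\<^sub>R x\<close>.\<close>
    then show ?thesis
      using le[OF assms, of x] le[of "inverse t" "t *\<^sub>R x"] assms by (simp add: field_simps)
  qed (use le[of 0 x] unit_gauge_nonneg[of 0] in simp)
qed

text \<open>A value below 1 would put a negative multiple of \<open>e\<close> into \<open>C\<close>,
  against pointedness and \<open>e \<noteq> 0\<close>.\<close>

lemma unit_gauge_unit: "unit_gauge e = 1"
proof (rule antisym)
  show "unit_gauge e \<le> 1" by (intro unit_gauge_le) (auto simp: ord_refl)
  show "1 \<le> unit_gauge e"
  proof (rule ccontr)
    assume "\<not> 1 \<le> unit_gauge e"
    moreover have "(unit_gauge e - 1) *\<^sub>R e \<in> C"
      using le_unit_gauge[of e] by (simp add: cone_le_def scaleR_diff_left)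
    then have "- ((1 - unit_gauge e) *\<^sub>R e) \<in> C" by (simp add: scaleR_diff_left)
    ultimately have "(1 - unit_gauge e) *\<^sub>R e = 0"
      using scale_mem[OF unit_mem] by (intro mem_uminus_eq_0) auto
    then show False using unit \<open>\<not> 1 \<le> unit_gauge e\<close> by simp
  qed
qed

lemma unit_gauge_le_norm:
  obtains L where "0 < L" "\<And>x. unit_gauge x \<le> L * norm x"
proof -
  obtain L where L: "0 < L" "\<And>x. x \<preceq> (L * norm x) *\<^sub>R e"
    using interior_dominates[OF unit(1)] by blast
  then show thesis by (intro that[of L] unit_gauge_le) auto
qed

text \<open>Normality applied to \<open>x \<preceq> unit_gauge x *\<^sub>R e\<close>. With
  \<open>unit_gauge_le_norm\<close>, gauge and norm are equivalent on \<open>C\<close>.\<close>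

lemma norm_le_unit_gauge:
  obtains N where "0 < N" "\<And>x. x \<in> C \<Longrightarrow> norm x \<le> N * unit_gauge x"
proof -
  obtain M where M: "0 < M" "\<And>x y. x \<in> C \<Longrightarrow> x \<preceq> y \<Longrightarrow> norm x \<le> M * norm y"
    using normal_bound by blast
  show thesis
  proof (rule that[of "M * norm e"])
    show "norm x \<le> M * norm e * unit_gauge x" if "x \<in> C" for x
      using M(2)[OF that le_unit_gauge] unit_gauge_nonneg[of x] by (simp add: mult_ac)
  qed (use M unit in simp)
qed

end

section \<open>Monotone homogeneous maps and bounds for their cone spectral radius\<close>

locale monotone_map = ordered_cone +
  fixes f :: "'a \<Rightarrow> 'a"
  assumes self_map: "f ` C \<subseteq> C"
    and homogeneous: "pos_homogeneous_on C f"
    and monotone: "order_preserving_on C f"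
begin

lemma map_mem: "x \<in> C \<Longrightarrow> f x \<in> C"
  using self_map by auto

lemma funpow_mem: "x \<in> C \<Longrightarrow> (f ^^ k) x \<in> C"
  by (induction k) (auto intro: map_mem)

lemma map_scale:
  assumes "x \<in> C" "0 \<le> t" shows "f (t *\<^sub>R x) = t *\<^sub>R f x"
proof -
  have scale: "f (t *\<^sub>R x) = t *\<^sub>R f x" if "x \<in> C" "0 < t" for t x
    using homogeneous that by (auto simp: pos_homogeneous_on_def)
  \<comment> \<open>Homogeneity is given for \<open>t > 0\<close>; doubling 0 yields
    \<open>f 0 = f 0 + f 0\<close> and so covers \<open>t = 0\<close>.\<close>
  have "f 0 = 0" using scale[OF zero_mem, of 2] by (simp add: scaleR_2)
  then show ?thesis using scale assms by (cases "t = 0") auto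
qed

lemma map_mono: "x \<in> C \<Longrightarrow> x \<preceq> y \<Longrightarrow> f x \<preceq> f y"
  using monotone le_mem[of x y] by (auto simp: order_preserving_on_def)

lemma funpow_mono: "x \<in> C \<Longrightarrow> x \<preceq> y \<Longrightarrow> (f ^^ k) x \<preceq> (f ^^ k) y"
  by (induction k) (auto intro: map_mono funpow_mem)

lemma funpow_scale: "x \<in> C \<Longrightarrow> 0 \<le> t \<Longrightarrow> (f ^^ k) (t *\<^sub>R x) = t *\<^sub>R (f ^^ k) x"
  by (induction k) (auto simp: map_scale funpow_mem)

lemma funpow_le:
  assumes "u \<in> C" "f u \<preceq> c *\<^sub>R u" "0 \<le> c"
  shows "(f ^^ k) u \<preceq> c ^ k *\<^sub>R u"
proof (induction k)
  case (Suc k)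
  have "f ((f ^^ k) u) \<preceq> c ^ k *\<^sub>R f u"
    using map_mono[OF funpow_mem Suc] assms by (simp add: map_scale)
  also have "\<dots> \<preceq> c ^ k *\<^sub>R c *\<^sub>R u" using assms by (intro le_scale) auto
  finally show ?case by (simp add: mult.commute)
qed (simp add: ord_refl)

lemma funpow_ge:
  assumes "u \<in> C" "c *\<^sub>R u \<preceq> f u" "0 \<le> c"
  shows "c ^ k *\<^sub>R u \<preceq> (f ^^ k) u"
proof (induction k)
  case (Suc k)
  have "c ^ k *\<^sub>R c *\<^sub>R u \<preceq> c ^ k *\<^sub>R f u" using assms by (intro le_scale) auto
  also have "\<dots> \<preceq> f ((f ^^ k) u)"
    using map_mono[OF scale_mem Suc] assms by (simp add: map_scale)
  finally show ?case by (simp add: mult.commute)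
qed (simp add: ord_refl)

lemma cone_spectral_radius_nonneg: "0 \<le> cone_spectral_radius C f"
  unfolding cone_spectral_radius_def
  by (intro SUP_upper2[OF zero_mem] le_Limsup always_eventually) (auto intro: real_root_ge_zero)

text \<open>Each \<open>x\<close> lies below a multiple \<open>t *\<^sub>R u\<close>, so its
  iterates lie below \<open>t *\<^sub>R c ^ k *\<^sub>R u\<close>. Normality bounds their norms by
  \<open>c ^ k * D\<close> with \<open>D\<close> independent of \<open>k\<close>, and
  \<open>root k D\<close> tends to 1.\<close>

lemma cone_spectral_radius_le:
  assumes u: "u \<in> interior C" "f u \<preceq> c *\<^sub>R u" and c: "0 < c"
  shows "cone_spectral_radius C f \<le> ereal c"
  unfolding cone_spectral_radius_def
proof (rule SUP_least)
  fix x assume x: "x \<in> C"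
  obtain L where L: "0 < L" "\<And>x. x \<preceq> (L * norm x) *\<^sub>R u"
    using interior_dominates[OF u(1)] by blast
  obtain M where M: "0 < M" "\<And>x y. x \<in> C \<Longrightarrow> x \<preceq> y \<Longrightarrow> norm x \<le> M * norm y"
    using normal_bound by blast
  have uC: "u \<in> C" using u interior_subset by auto
  define t where "t = L * norm x"
  \<comment> \<open>The summand 1 keeps \<open>D\<close> positive even for \<open>x = 0\<close>, as
    the limit of \<open>root k D\<close> requires.\<close>
  define D where "D = M * t * norm u + 1"
  have t: "0 \<le> t" using L by (simp add: t_def)
  have D: "0 < D" using t M unfolding D_def by (intro add_nonneg_pos mult_nonneg_nonneg) auto
  have le: "root k (norm ((f ^^ k) x)) \<le> c * root k D" if "0 < k" for k
  proof -
    have "(f ^^ k) x \<preceq> (f ^^ k) (t *\<^sub>R u)"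
      using L(2) x unfolding t_def by (intro funpow_mono)
    also have "\<dots> = t *\<^sub>R (f ^^ k) u" using t uC by (intro funpow_scale)
    also have "\<dots> \<preceq> t *\<^sub>R c ^ k *\<^sub>R u" using t u uC c by (intro le_scale funpow_le) auto
    finally have "norm ((f ^^ k) x) \<le> M * norm (t *\<^sub>R c ^ k *\<^sub>R u)"
      using x by (intro M funpow_mem) auto
    also have "\<dots> = c ^ k * (M * t * norm u)" using t c by simp
    also have "\<dots> \<le> c ^ k * D" using c unfolding D_def by (intro mult_left_mono) auto
    finally have "root k (norm ((f ^^ k) x)) \<le> root k (c ^ k * D)" using that by simp
    then show ?thesis using that c by (simp add: real_root_mult real_root_power_cancel)
  qed
  have "(\<lambda>k. c * root k D) \<longlonglongrightarrow> c * 1"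
    by (intro tendsto_mult tendsto_const LIMSEQ_root_const D)
  then have "limsup (\<lambda>k. ereal (c * root k D)) = ereal c"
    by (intro lim_imp_Limsup) auto
  moreover have "limsup (\<lambda>k. ereal (root k (norm ((f ^^ k) x)))) \<le> limsup (\<lambda>k. ereal (c * root k D))"
    using le by (intro Limsup_mono) (auto simp: eventually_sequentially intro!: exI[of _ 1])
  ultimately show "limsup (\<lambda>k. ereal (root k (norm ((f ^^ k) x)))) \<le> ereal c" by simp
qed

text \<open>The iterates of \<open>v\<close> are \<open>c ^ k *\<^sub>R v\<close>, and
  \<open>root k (norm v)\<close> tends to 1. This is the upper bound in the maximum formula.\<close>

lemma eigenvalue_le_cone_spectral_radius:
  assumes v: "v \<in> C" "v \<noteq> 0" "f v = c *\<^sub>R v" and c: "0 \<le> c"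
  shows "ereal c \<le> cone_spectral_radius C f"
proof -
  have pow: "(f ^^ k) v = c ^ k *\<^sub>R v" for k
    by (induction k) (use v c in \<open>auto simp: map_scale mult.commute\<close>)
  have "(\<lambda>k. c * root k (norm v)) \<longlonglongrightarrow> c * 1"
    using v by (intro tendsto_mult tendsto_const LIMSEQ_root_const) auto
  moreover have "eventually (\<lambda>k. c * root k (norm v) = root k (norm ((f ^^ k) v))) sequentially"
    using c by (auto simp: eventually_sequentially pow real_root_mult real_root_power_cancel
        intro!: exI[of _ 1])
  ultimately have "(\<lambda>k. root k (norm ((f ^^ k) v))) \<longlonglongrightarrow> c * 1"
    by (rule Lim_transform_eventually)
  then have "limsup (\<lambda>k. ereal (root k (norm ((f ^^ k) v)))) = ereal c"
    by (intro lim_imp_Limsup) auto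
  then show ?thesis
    unfolding cone_spectral_radius_def by (intro SUP_upper2[OF v(1)]) simp
qed

end

section \<open>Perturbation by a multiple of the unit; approximate eigenvectors\<close>

locale monotone_map_unit = cone_with_unit + monotone_map
begin

text \<open>Condenses a bound on the spectral radius into a strict inequality for a single iterate,
  which survives small perturbations of \<open>f\<close>. With \<open>d\<close> between the growth
  rate of \<open>e\<close> and \<open>c\<close>, the constant \<open>L\<close> between gauge and
  norm is absorbed by \<open>(d / c) ^ k\<close>, which tends to 0.\<close>

lemma unit_gauge_funpow_less:
  assumes "cone_spectral_radius C f < ereal c"
  obtains m where "unit_gauge ((f ^^ m) e) < c ^ m"
proof -
  have "limsup (\<lambda>k. ereal (root k (norm ((f ^^ k) e)))) \<le> cone_spectral_radius C f"
    unfolding cone_spectral_radius_def by (rule SUP_upper[OF unit_mem])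
  also note assms
  finally obtain d where d: "limsup (\<lambda>k. ereal (root k (norm ((f ^^ k) e)))) < ereal d" "d < c"
    using ereal_dense2 by fastforce
  have "0 \<le> limsup (\<lambda>k. ereal (root k (norm ((f ^^ k) e))))"
    by (intro le_Limsup always_eventually) (auto intro: real_root_ge_zero)
  then have d0: "0 < d" using d(1) by (metis le_less_trans ereal_less(2))
  have ev: "eventually (\<lambda>k. ereal (root k (norm ((f ^^ k) e))) < ereal d) sequentially"
    using d(1) by (rule Limsup_lessD)
  obtain L where L: "0 < L" "\<And>x. unit_gauge x \<le> L * norm x" using unit_gauge_le_norm by blast
  have "(\<lambda>k. L * (d / c) ^ k) \<longlonglongrightarrow> L * 0"
    using d d0 by (intro tendsto_mult tendsto_const LIMSEQ_power_zero) auto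
  then have "eventually (\<lambda>k. L * (d / c) ^ k < 1) sequentially"
    by (intro order_tendstoD(2)[of _ 0]) auto
  with ev have "eventually (\<lambda>k. unit_gauge ((f ^^ k) e) < c ^ k) sequentially"
    using eventually_gt_at_top[of 0]
  proof eventually_elim
    case (elim k)
    have "root k (norm ((f ^^ k) e)) ^ k \<le> d ^ k"
      using elim by (intro power_mono) auto
    then have "norm ((f ^^ k) e) \<le> d ^ k" using elim by simp
    then have "L * norm ((f ^^ k) e) \<le> L * d ^ k" using L by simp
    moreover have "L * d ^ k < c ^ k" using elim d d0 by (simp add: power_divide field_simps)
    ultimately show ?case using L(2)[of "(f ^^ k) e"] by linarith
  qed
  then show thesis using that by (auto simp: eventually_sequentially)
qed

text \<open>The map \<open>H\<close> of the overview, with \<open>d\<close> in the role of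
  \<delta>.\<close>

definition perturb :: "real \<Rightarrow> 'a \<Rightarrow> 'a" where
  "perturb d x = f x + (d * unit_gauge x) *\<^sub>R e"

lemma map_le_unit_gauge:
  assumes "x \<in> C" shows "f x \<preceq> (unit_gauge (f e) * unit_gauge x) *\<^sub>R e"
proof -
  have "f x \<preceq> f (unit_gauge x *\<^sub>R e)" using assms by (intro map_mono le_unit_gauge)
  also have "\<dots> = unit_gauge x *\<^sub>R f e" by (intro map_scale unit_mem unit_gauge_nonneg)
  also have "\<dots> \<preceq> unit_gauge x *\<^sub>R unit_gauge (f e) *\<^sub>R e" by (intro le_scale le_unit_gauge unit_gauge_nonneg)
  finally show ?thesis by (simp add: mult.commute)
qed

lemma monotone_map_perturb:
  assumes "0 \<le> d" shows "monotone_map C (perturb d)"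
proof
  show "perturb d ` C \<subseteq> C"
    using assms unfolding perturb_def
    by (auto intro!: add_mem map_mem scale_mem unit_mem mult_nonneg_nonneg unit_gauge_nonneg)
  show "pos_homogeneous_on C (perturb d)"
    unfolding pos_homogeneous_on_def perturb_def
    by (auto simp: map_scale unit_gauge_scale scaleR_add_right mult_ac)
  show "order_preserving_on C (perturb d)"
    unfolding order_preserving_on_def perturb_def using assms
    by (auto intro!: le_add_mono map_mono scale_le_scale unit_mem mult_left_mono unit_gauge_mono)
qed

text \<open>Monotonicity places \<open>f x\<close> between \<open>a *\<^sub>R f y\<close> and
  \<open>b *\<^sub>R f y\<close>. The added terms have the exact ratio \<open>s\<close>, which lies
  in \<open>[a, b]\<close>, so they leave slacks \<open>(s - a) * d * unit_gauge y\<close> and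
  \<open>(b - s) * d * unit_gauge y\<close> along \<open>e\<close>. These dominate the multiples
  \<open>(s - a) * c\<close> and \<open>(b - s) * c\<close> of \<open>perturb d y\<close>; in total
  the gap shrinks by \<open>c * (b - a)\<close>.\<close>

lemma perturb_contraction:
  assumes x: "x \<in> C" and y: "y \<in> C" "0 < unit_gauge y" and d: "0 < d" and a: "0 \<le> a"
    and le: "a *\<^sub>R y \<preceq> x" "x \<preceq> b *\<^sub>R y"
  defines "c \<equiv> d / (unit_gauge (f e) + d)"
  obtains a' b' where "a \<le> a'" "b' - a' = (1 - c) * (b - a)"
    "a' *\<^sub>R perturb d y \<preceq> perturb d x" "perturb d x \<preceq> b' *\<^sub>R perturb d y"
proof -
  define s where "s = unit_gauge x / unit_gauge y"
  define K where "K = unit_gauge (f e)"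
  have K: "0 \<le> K" unfolding K_def by (rule unit_gauge_nonneg)
  have c: "0 < c" "c * (K + d) = d" using d K by (auto simp: c_def K_def)
  have s: "unit_gauge x = s * unit_gauge y" using y by (simp add: s_def)
  have "a * unit_gauge y \<le> unit_gauge x"
    using unit_gauge_mono[OF le(1)] a by (simp add: unit_gauge_scale)
  then have as: "a \<le> s" using y by (simp add: s)
  \<comment> \<open>Needed to pull \<open>b\<close> out of \<open>f\<close>. A negative
    \<open>b\<close> would give \<open>- y \<in> C\<close>, hence \<open>y = 0\<close>, against the
    positive gauge.\<close>
  have b: "0 \<le> b"
  proof (rule ccontr)
    assume "\<not> 0 \<le> b"
    then have "- y \<in> C"
      using scale_mem[of "b *\<^sub>R y" "inverse (- b)"] le_mem[OF x le(2)] by simp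
    then show False using mem_uminus_eq_0[OF y(1)] y(2) unit_gauge_scale[of 0 0] by simp
  qed
  have "unit_gauge x \<le> b * unit_gauge y"
    using unit_gauge_mono[OF le(2)] b by (simp add: unit_gauge_scale)
  then have sb: "s \<le> b" using y by (simp add: s)
  \<comment> \<open>The uniform comparison of \<open>perturb d y\<close> with \<open>e\<close> from
    above; it is what makes the map contract.\<close>
  have Z: "((K + d) * unit_gauge y) *\<^sub>R e - perturb d y \<in> C"
    using map_le_unit_gauge[OF y(1)] unfolding perturb_def cone_le_def K_def
    by (simp add: algebra_simps)
  have fa: "f x - a *\<^sub>R f y \<in> C"
    using map_mono[OF _ le(1)] scale_mem[OF y(1) a] map_scale[OF y(1) a] by (simp add: cone_le_def)
  have fb: "b *\<^sub>R f y - f x \<in> C"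
    using map_mono[OF x le(2)] map_scale[OF y(1) b] by (simp add: cone_le_def)
  \<comment> \<open>The choice of \<open>c\<close> makes \<open>d = c * (K + d)\<close>, so slack
    minus gain is a multiple of the vector in \<open>Z\<close>.\<close>
  have eq: "(t * d * unit_gauge y) *\<^sub>R e - (t * c) *\<^sub>R perturb d y =
      (t * c) *\<^sub>R (((K + d) * unit_gauge y) *\<^sub>R e - perturb d y)" for t
  proof -
    have "t * d * unit_gauge y = t * c * ((K + d) * unit_gauge y)" by (metis c(2) mult.assoc)
    then show ?thesis by (simp add: scaleR_diff_right)
  qed
  have "(f x - a *\<^sub>R f y) + ((s - a) * c) *\<^sub>R (((K + d) * unit_gauge y) *\<^sub>R e - perturb d y) \<in> C"
    using as c by (intro add_mem fa scale_mem Z) auto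
  then have 1: "(f x - a *\<^sub>R f y) + (((s - a) * d * unit_gauge y) *\<^sub>R e - ((s - a) * c) *\<^sub>R perturb d y) \<in> C"
    unfolding eq .
  have "(b *\<^sub>R f y - f x) + ((b - s) * c) *\<^sub>R (((K + d) * unit_gauge y) *\<^sub>R e - perturb d y) \<in> C"
    using sb c by (intro add_mem fb scale_mem Z) auto
  then have 2: "(b *\<^sub>R f y - f x) + (((b - s) * d * unit_gauge y) *\<^sub>R e - ((b - s) * c) *\<^sub>R perturb d y) \<in> C"
    unfolding eq .
  show thesis
  proof (rule that[of "a + (s - a) * c" "b - (b - s) * c"])
    show "a \<le> a + (s - a) * c" using as c by simp
    show "b - (b - s) * c - (a + (s - a) * c) = (1 - c) * (b - a)" by (simp add: algebra_simps)
    have "perturb d x - (a + (s - a) * c) *\<^sub>R perturb d y =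
      (f x - a *\<^sub>R f y) + (((s - a) * d * unit_gauge y) *\<^sub>R e - ((s - a) * c) *\<^sub>R perturb d y)"
      unfolding scaleR_add_left by (simp add: perturb_def s algebra_simps)
    then show "(a + (s - a) * c) *\<^sub>R perturb d y \<preceq> perturb d x" using 1 by (simp add: cone_le_def)
    have "(b - (b - s) * c) *\<^sub>R perturb d y - perturb d x =
      (b *\<^sub>R f y - f x) + (((b - s) * d * unit_gauge y) *\<^sub>R e - ((b - s) * c) *\<^sub>R perturb d y)"
      unfolding scaleR_diff_left by (simp add: perturb_def s algebra_simps)
    then show "perturb d x \<preceq> (b - (b - s) * c) *\<^sub>R perturb d y" using 2 by (simp add: cone_le_def)
  qed
qed

text \<open>The contraction is applied to consecutive iterates \<open>x\<close> and
  \<open>perturb d x\<close>, starting from \<open>e\<close>. Once the gap \<open>b - a\<close> is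
  below \<open>d\<close>, the upper bound is relaxed to \<open>a + d\<close> and the iterate is
  scaled to gauge 1. Finitely many iterations suffice, so no limit in the cone is taken.\<close>

lemma approximate_eigenvector:
  assumes d: "0 < d"
  obtains u a where "u \<in> C" "unit_gauge u = 1" "0 < a"
    "a *\<^sub>R u \<preceq> perturb d u" "perturb d u \<preceq> (a + d) *\<^sub>R u"
proof -
  interpret H: monotone_map C "perturb d" using d by (intro monotone_map_perturb) auto
  define K where "K = unit_gauge (f e)"
  define c where "c = d / (K + d)"
  have K: "0 \<le> K" unfolding K_def by (rule unit_gauge_nonneg)
  have c: "0 < c" "c \<le> 1" using d K by (auto simp: c_def)
  have "\<exists>x a b. x \<in> C \<and> 0 < unit_gauge x \<and> 0 < a \<and> b - a = (1 - c) ^ k * K \<and>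
    a *\<^sub>R x \<preceq> perturb d x \<and> perturb d x \<preceq> b *\<^sub>R x" for k
  proof (induction k)
    case 0
    \<comment> \<open>The initial bounds are \<open>d\<close> and \<open>K + d\<close>, with gap
      \<open>K\<close>.\<close>
    have "d *\<^sub>R e \<preceq> perturb d e"
      using map_mem[OF unit_mem] by (simp add: perturb_def unit_gauge_unit cone_le_def)
    moreover have "perturb d e \<preceq> (K + d) *\<^sub>R e"
      using le_unit_gauge[of "f e"] by (simp add: perturb_def unit_gauge_unit cone_le_def K_def algebra_simps)
    ultimately show ?case
      using unit_mem unit_gauge_unit d
      by (intro exI[of _ e] exI[of _ d] exI[of _ "K + d"]) auto
  next
    case (Suc k)
    then obtain x a b where x: "x \<in> C" "0 < unit_gauge x" "0 < a" "b - a = (1 - c) ^ k * K"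
      "a *\<^sub>R x \<preceq> perturb d x" "perturb d x \<preceq> b *\<^sub>R x" by blast
    obtain a' b' where ab: "a \<le> a'" "b' - a' = (1 - c) * (b - a)"
      "a' *\<^sub>R perturb d x \<preceq> perturb d (perturb d x)"
      "perturb d (perturb d x) \<preceq> b' *\<^sub>R perturb d x"
      using perturb_contraction[OF H.map_mem[OF x(1)] x(1,2) d _ x(5,6)] x(3)
      unfolding c_def K_def by (metis less_imp_le)
    \<comment> \<open>The positive lower bound \<open>a\<close> keeps the gauge of the next iterate
      positive.\<close>
    have "0 < a * unit_gauge x" using x by simp
    also have "\<dots> \<le> unit_gauge (perturb d x)"
      using unit_gauge_mono[OF x(5)] x(3) by (simp add: unit_gauge_scale)
    finally show ?case
      using H.map_mem[OF x(1)] ab x(3,4)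
      by (intro exI[of _ "perturb d x"] exI[of _ a'] exI[of _ b']) auto
  qed
  moreover have "(\<lambda>k. (1 - c) ^ k * K) \<longlonglongrightarrow> 0 * K"
    using c by (intro tendsto_mult tendsto_const LIMSEQ_power_zero) auto
  then have "eventually (\<lambda>k. (1 - c) ^ k * K < d) sequentially"
    using d by (intro order_tendstoD(2)[of _ 0]) auto
  then obtain k where "(1 - c) ^ k * K < d" by (auto simp: eventually_sequentially)
  ultimately obtain x a b where x: "x \<in> C" "0 < unit_gauge x" "0 < a" "b - a < d"
      "a *\<^sub>R x \<preceq> perturb d x" "perturb d x \<preceq> b *\<^sub>R x" by metis
  define t where "t = inverse (unit_gauge x)"
  have t: "0 < t" using x by (simp add: t_def)
  have H: "perturb d (t *\<^sub>R x) = t *\<^sub>R perturb d x"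
    using x t by (intro H.map_scale) auto
  show thesis
  proof (rule that[of "t *\<^sub>R x" a])
    show tx: "t *\<^sub>R x \<in> C" using x t by (intro scale_mem) auto
    show "unit_gauge (t *\<^sub>R x) = 1" using x t by (simp add: unit_gauge_scale t_def)
    show "a *\<^sub>R t *\<^sub>R x \<preceq> perturb d (t *\<^sub>R x)"
      using le_scale[OF x(5), of t] t by (simp add: H mult.commute)
    have "perturb d (t *\<^sub>R x) \<preceq> b *\<^sub>R t *\<^sub>R x"
      using le_scale[OF x(6), of t] t by (simp add: H mult.commute)
    also have "\<dots> \<preceq> (a + d) *\<^sub>R t *\<^sub>R x" using x(4) by (intro scale_le_scale tx) auto
    finally show "perturb d (t *\<^sub>R x) \<preceq> (a + d) *\<^sub>R t *\<^sub>R x" .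
  qed (use x in auto)
qed

end

section \<open>Vanishing perturbation and the infimum formula\<close>

locale uniformly_continuous_map = monotone_map_unit +
  assumes uniform: "\<And>B. B \<subseteq> C \<Longrightarrow> bounded B \<Longrightarrow> uniformly_continuous_on B f"
begin

lemma map_tendsto:
  assumes "\<And>n. X n \<in> C" "x \<in> C" "X \<longlonglongrightarrow> x"
  shows "(\<lambda>n. f (X n)) \<longlonglongrightarrow> f x"
proof -
  let ?B = "insert x (range X)"
  have "bounded ?B" using assms(3) convergent_imp_bounded by auto
  then have "continuous_on ?B f"
    using assms by (intro uniformly_continuous_imp_continuous uniform) auto
  then show ?thesis
    using assms(3) by (rule continuous_on_tendsto_compose) auto
qed

text \<open>By induction the inner iterates converge, so their norms stay bounded and the added term
  vanishes with \<open>d n\<close>; \<open>map_tendsto\<close> handles the rest.\<close>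

lemma perturb_funpow_tendsto:
  assumes d: "\<And>n. 0 \<le> d n" "d \<longlonglongrightarrow> 0"
  shows "(\<lambda>n. (perturb (d n) ^^ m) e) \<longlonglongrightarrow> (f ^^ m) e"
proof (induction m)
  case (Suc m)
  let ?X = "\<lambda>n. (perturb (d n) ^^ m) e"
  have X: "?X n \<in> C" for n
    using monotone_map.funpow_mem[OF monotone_map_perturb unit_mem] d by blast
  obtain L where L: "0 < L" "\<And>x. unit_gauge x \<le> L * norm x" using unit_gauge_le_norm by blast
  have "(\<lambda>n. d n * unit_gauge (?X n)) \<longlonglongrightarrow> 0"
  proof (rule tendsto_sandwich[where f = "\<lambda>_. 0"])
    have "(\<lambda>n. d n * (L * norm (?X n))) \<longlonglongrightarrow> 0 * (L * norm ((f ^^ m) e))"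
      by (intro tendsto_intros d Suc)
    then show "(\<lambda>n. d n * (L * norm (?X n))) \<longlonglongrightarrow> 0" by simp
    show "eventually (\<lambda>n. d n * unit_gauge (?X n) \<le> d n * (L * norm (?X n))) sequentially"
      by (intro always_eventually allI mult_left_mono L d)
    show "eventually (\<lambda>n. 0 \<le> d n * unit_gauge (?X n)) sequentially"
      by (intro always_eventually allI mult_nonneg_nonneg d unit_gauge_nonneg)
  qed simp
  then have "(\<lambda>n. f (?X n) + (d n * unit_gauge (?X n)) *\<^sub>R e) \<longlonglongrightarrow> f ((f ^^ m) e) + 0 *\<^sub>R e"
    by (intro tendsto_intros map_tendsto X Suc funpow_mem unit_mem)
  then have "(\<lambda>n. perturb (d n) (?X n)) \<longlonglongrightarrow> f ((f ^^ m) e)"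
    unfolding perturb_def[of _ "(perturb _ ^^ m) e"] by simp
  then show ?case by simp
qed simp

text \<open>Fix \<open>m\<close> with \<open>unit_gauge ((f ^^ m) e) < c ^ m\<close>. Since
  \<open>u n \<preceq> e\<close>, the vector \<open>a n ^ m *\<^sub>R u n\<close> lies below the
  \<open>m\<close>-th perturbed iterate of \<open>e\<close>; taking gauges bounds
  \<open>a n ^ m\<close>, and these iterates converge to \<open>(f ^^ m) e\<close>.\<close>

lemma approximate_eigenvalue_le:
  assumes d: "\<And>n. 0 \<le> d n" "d \<longlonglongrightarrow> 0"
    and u: "\<And>n. u n \<in> C" "\<And>n. unit_gauge (u n) = 1"
    and a: "\<And>n. 0 < a n" "\<And>n. a n *\<^sub>R u n \<preceq> perturb (d n) (u n)"
    and c: "cone_spectral_radius C f < ereal c"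
  shows "eventually (\<lambda>n. a n < c) sequentially"
proof -
  obtain m where m: "unit_gauge ((f ^^ m) e) < c ^ m" using unit_gauge_funpow_less[OF c] .
  have c0: "0 < c" using cone_spectral_radius_nonneg c by (metis ereal_less(2) le_less_trans)
  obtain L where L: "0 < L" "\<And>x. unit_gauge x \<le> L * norm x" using unit_gauge_le_norm by blast
  let ?X = "\<lambda>n. (perturb (d n) ^^ m) e"
  have "(\<lambda>n. unit_gauge ((f ^^ m) e) + L * norm (?X n - (f ^^ m) e)) \<longlonglongrightarrow>
      unit_gauge ((f ^^ m) e) + L * norm ((f ^^ m) e - (f ^^ m) e)"
    by (intro tendsto_intros perturb_funpow_tendsto d)
  then have "eventually (\<lambda>n. unit_gauge ((f ^^ m) e) + L * norm (?X n - (f ^^ m) e) < c ^ m) sequentially"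
    using m by (intro order_tendstoD(2)) auto
  then show ?thesis
  proof eventually_elim
    case (elim n)
    interpret H: monotone_map C "perturb (d n)" using d by (intro monotone_map_perturb) auto
    have "a n ^ m *\<^sub>R u n \<preceq> (perturb (d n) ^^ m) (u n)"
      using u a by (intro H.funpow_ge) (auto intro: less_imp_le)
    also have "\<dots> \<preceq> ?X n"
      using le_unit_gauge[of "u n"] u by (intro H.funpow_mono) auto
    finally have "a n ^ m \<le> unit_gauge (?X n)"
      using unit_gauge_mono[of "a n ^ m *\<^sub>R u n"] a(1)[of n] u by (simp add: unit_gauge_scale)
    \<comment> \<open>The gauge is subadditive and at most \<open>L\<close> times the norm, which
      replaces an appeal to its continuity.\<close>
    moreover have "unit_gauge (?X n) \<le> unit_gauge ((f ^^ m) e) + L * norm (?X n - (f ^^ m) e)"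
    proof (intro unit_gauge_le add_nonneg_nonneg unit_gauge_nonneg)
      have "(f ^^ m) e + (?X n - (f ^^ m) e) \<preceq>
          unit_gauge ((f ^^ m) e) *\<^sub>R e + unit_gauge (?X n - (f ^^ m) e) *\<^sub>R e"
        by (intro le_add_mono le_unit_gauge)
      also have "\<dots> \<preceq> unit_gauge ((f ^^ m) e) *\<^sub>R e + (L * norm (?X n - (f ^^ m) e)) *\<^sub>R e"
        by (intro le_add_mono ord_refl scale_le_scale unit_mem L)
      finally show "?X n \<preceq> (unit_gauge ((f ^^ m) e) + L * norm (?X n - (f ^^ m) e)) *\<^sub>R e"
        by (simp add: scaleR_add_left)
    qed (use L in auto)
    ultimately have "a n ^ m < c ^ m" using elim by linarith
    then show ?case using c0 power_less_imp_less_base[of "a n" m c] by simp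
  qed
qed

text \<open>Both claims come from \<open>f u + d *\<^sub>R e \<preceq> (a + d) *\<^sub>R u\<close>:
  dropping \<open>d *\<^sub>R e\<close> gives the second, dropping \<open>f u\<close> puts
  \<open>u\<close> above a positive multiple of \<open>e\<close>.\<close>

lemma approximate_eigenvector_le:
  assumes "0 < d" "u \<in> C" "unit_gauge u = 1" "0 < a" "perturb d u \<preceq> (a + d) *\<^sub>R u"
  shows "u \<in> interior C" "f u \<preceq> (a + d) *\<^sub>R u"
proof -
  have "f u + d *\<^sub>R e \<preceq> (a + d) *\<^sub>R u"
    using assms by (simp add: perturb_def)
  moreover have "f u \<preceq> f u + d *\<^sub>R e" "d *\<^sub>R e \<preceq> f u + d *\<^sub>R e"
    using assms map_mem scale_mem[OF unit_mem] by (auto simp: cone_le_def)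
  ultimately have le: "f u \<preceq> (a + d) *\<^sub>R u" "d *\<^sub>R e \<preceq> (a + d) *\<^sub>R u"
    by (blast intro: ord_trans)+
  then show "f u \<preceq> (a + d) *\<^sub>R u" by simp
  have "(inverse (a + d) * d) *\<^sub>R e \<preceq> u"
    using le_scale[OF le(2), of "inverse (a + d)"] assms by simp
  then show "u \<in> interior C"
    using assms by (intro interior_upward[OF unit(1)]) auto
qed

lemma approximate_eigenvector_sequence:
  obtains d u a where "\<And>n. 0 < d n" "d \<longlonglongrightarrow> 0" "\<And>n. u n \<in> C" "\<And>n. unit_gauge (u n) = 1"
    "\<And>n. 0 < a n" "\<And>n. a n *\<^sub>R u n \<preceq> perturb (d n) (u n)"
    "\<And>n. perturb (d n) (u n) \<preceq> (a n + d n) *\<^sub>R u n" "\<And>n. u n \<in> interior C"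
    "\<And>n. f (u n) \<preceq> (a n + d n) *\<^sub>R u n"
proof -
  define d where "d n = inverse (real (Suc n))" for n
  have d: "0 < d n" for n by (simp add: d_def)
  have "\<exists>u a. u \<in> C \<and> unit_gauge u = 1 \<and> 0 < a \<and>
    a *\<^sub>R u \<preceq> perturb (d n) u \<and> perturb (d n) u \<preceq> (a + d n) *\<^sub>R u" for n
    using approximate_eigenvector[OF d] by metis
  then obtain u a where ua: "\<And>n. u n \<in> C" "\<And>n. unit_gauge (u n) = 1" "\<And>n. 0 < a n"
    "\<And>n. a n *\<^sub>R u n \<preceq> perturb (d n) (u n)" "\<And>n. perturb (d n) (u n) \<preceq> (a n + d n) *\<^sub>R u n"
    by metis
  show thesis
  proof (rule that[of d u a])
    show "d \<longlonglongrightarrow> 0" unfolding d_def by (rule LIMSEQ_inverse_real_of_nat)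
  qed (fact d ua approximate_eigenvector_le[OF d ua(1,2,3,5)])+
qed

lemma cone_spectral_radius_eq_Inf:
  "cone_spectral_radius C f =
     Inf (ereal ` {c. c > 0 \<and> (\<exists>u\<in>interior C. f u \<preceq> c *\<^sub>R u)})" (is "_ = Inf ?S")
proof (rule antisym)
  show "cone_spectral_radius C f \<le> Inf ?S"
    by (auto intro!: Inf_greatest cone_spectral_radius_le)
  obtain d u a where s: "\<And>n. 0 < d n" "d \<longlonglongrightarrow> 0" "\<And>n. u n \<in> C" "\<And>n. unit_gauge (u n) = 1"
    "\<And>n. 0 < a n" "\<And>n. a n *\<^sub>R u n \<preceq> perturb (d n) (u n)" "\<And>n. u n \<in> interior C"
    "\<And>n. f (u n) \<preceq> (a n + d n) *\<^sub>R u n"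
    using approximate_eigenvector_sequence by metis
  show "Inf ?S \<le> cone_spectral_radius C f"
  proof (rule ccontr)
    assume "\<not> ?thesis"
    then have "cone_spectral_radius C f < Inf ?S" by simp
    then obtain c where c: "cone_spectral_radius C f < ereal c" "ereal c < Inf ?S"
      using ereal_dense2 by blast
    \<comment> \<open>Two levels above the spectral radius: \<open>c\<close> bounds
      \<open>a n\<close>, and the gap \<open>b - c\<close> leaves room for
      \<open>d n\<close>.\<close>
    then obtain b where b: "ereal c < ereal b" "ereal b < Inf ?S"
      using ereal_dense2 by blast
    have "eventually (\<lambda>n. a n < c) sequentially"
      using s c(1) by (intro approximate_eigenvalue_le) (auto intro: less_imp_le)
    moreover have "eventually (\<lambda>n. d n < b - c) sequentially"
      using b s(2) by (intro order_tendstoD(2)) auto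
    ultimately have "eventually (\<lambda>n. a n + d n < b) sequentially"
      by eventually_elim simp
    then obtain n where n: "a n + d n < b" by (auto simp: eventually_sequentially)
    have "Inf ?S \<le> ereal (a n + d n)"
      using s(1,5)[of n] s(7,8) by (intro Inf_lower imageI) (auto intro!: bexI[of _ "u n"])
    also have "\<dots> < ereal b" using n by simp
    finally show False using b(2) by simp
  qed
qed

section \<open>Residuals, noncompactness and the eigenvector\<close>

lemma funpow_bounded:
  assumes "B \<subseteq> C" "bounded B" shows "bounded ((f ^^ k) ` B)"
proof -
  obtain b where b: "\<And>x. x \<in> B \<Longrightarrow> norm x \<le> b" using assms(2) by (auto simp: bounded_iff)
  obtain L where L: "0 < L" "\<And>x. x \<preceq> (L * norm x) *\<^sub>R e"
    using interior_dominates[OF unit(1)] by blast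
  obtain M where M: "0 < M" "\<And>x y. x \<in> C \<Longrightarrow> x \<preceq> y \<Longrightarrow> norm x \<le> M * norm y"
    using normal_bound by blast
  \<comment> \<open>All of \<open>B\<close> lies below one multiple of \<open>e\<close>, so its
    image lies below one multiple of \<open>(f ^^ k) e\<close>. The maximum with 0 covers a negative
    \<open>b\<close>, possible for empty \<open>B\<close>.\<close>
  have "norm ((f ^^ k) x) \<le> M * norm ((L * max b 0) *\<^sub>R (f ^^ k) e)" if x: "x \<in> B" for x
  proof (rule M(2))
    show "(f ^^ k) x \<in> C" using x assms by (intro funpow_mem) auto
    have "L * norm x \<le> L * max b 0" using b[OF x] L by (intro mult_left_mono) auto
    then have "x \<preceq> (L * max b 0) *\<^sub>R e" by (intro ord_trans[OF L(2) scale_le_scale] unit_mem)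
    then have "(f ^^ k) x \<preceq> (f ^^ k) ((L * max b 0) *\<^sub>R e)"
      using x assms by (intro funpow_mono) auto
    also have "\<dots> = (L * max b 0) *\<^sub>R (f ^^ k) e" using L by (intro funpow_scale unit_mem) auto
    finally show "(f ^^ k) x \<preceq> (L * max b 0) *\<^sub>R (f ^^ k) e" .
  qed
  then show ?thesis by (auto simp: bounded_iff)
qed

text \<open>The residual for \<open>Suc k\<close> is \<open>f (?v n) - f (?w n)\<close> plus
  \<open>r ^ k\<close> times the original residual. The sequences need not converge, so the first
  difference is handled by uniform continuity on a bounded set containing both.\<close>

lemma funpow_approximate_eigenvector:
  assumes u: "\<And>n. u n \<in> C" "bounded (range u)" and r: "0 \<le> r"
    and lim: "(\<lambda>n. f (u n) - r *\<^sub>R u n) \<longlonglongrightarrow> 0"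
  shows "(\<lambda>n. (f ^^ k) (u n) - r ^ k *\<^sub>R u n) \<longlonglongrightarrow> 0"
proof (induction k)
  case (Suc k)
  let ?v = "\<lambda>n. (f ^^ k) (u n)" and ?w = "\<lambda>n. r ^ k *\<^sub>R u n"
  let ?B = "range ?v \<union> range ?w"
  have "bounded ?B"
    using funpow_bounded[of "range u" k] bounded_scaling[OF u(2), of "r ^ k"] u
    by (auto simp: image_image)
  moreover have "?B \<subseteq> C" using u r by (auto intro: funpow_mem scale_mem)
  ultimately have "uniformly_continuous_on ?B f" by (intro uniform)
  moreover have "(\<lambda>n. dist (?v n) (?w n)) \<longlonglongrightarrow> 0"
    using Suc by (simp add: dist_norm tendsto_norm_zero_iff)
  ultimately have "(\<lambda>n. dist (f (?v n)) (f (?w n))) \<longlonglongrightarrow> 0"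
    using uniformly_continuous_on_sequentially[THEN iffD1, rule_format, of ?B f ?v ?w] by blast
  then have "(\<lambda>n. f (?v n) - f (?w n)) \<longlonglongrightarrow> 0"
    by (auto simp: dist_norm tendsto_norm_zero_iff)
  moreover have "(\<lambda>n. r ^ k *\<^sub>R (f (u n) - r *\<^sub>R u n)) \<longlonglongrightarrow> r ^ k *\<^sub>R 0"
    by (intro tendsto_intros lim)
  ultimately have "(\<lambda>n. (f (?v n) - f (?w n)) + r ^ k *\<^sub>R (f (u n) - r *\<^sub>R u n)) \<longlonglongrightarrow> 0 + r ^ k *\<^sub>R 0"
    by (rule tendsto_add)
  moreover have "(f (?v n) - f (?w n)) + r ^ k *\<^sub>R (f (u n) - r *\<^sub>R u n) =
      (f ^^ Suc k) (u n) - r ^ Suc k *\<^sub>R u n" for n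
    using u r by (simp add: map_scale algebra_simps)
  ultimately show ?case by simp
qed simp

lemma approximate_eigenvector_residual:
  assumes r: "cone_spectral_radius C f = ereal r"
  obtains u where "\<And>n. u n \<in> C" "\<And>n. unit_gauge (u n) = 1" "(\<lambda>n. f (u n) - r *\<^sub>R u n) \<longlonglongrightarrow> 0"
proof -
  obtain d u a where s: "\<And>n. 0 < d n" "d \<longlonglongrightarrow> 0" "\<And>n. u n \<in> C" "\<And>n. unit_gauge (u n) = 1"
    "\<And>n. 0 < a n" "\<And>n. a n *\<^sub>R u n \<preceq> perturb (d n) (u n)"
    "\<And>n. perturb (d n) (u n) \<preceq> (a n + d n) *\<^sub>R u n" "\<And>n. u n \<in> interior C"
    "\<And>n. f (u n) \<preceq> (a n + d n) *\<^sub>R u n"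
    using approximate_eigenvector_sequence by metis
  \<comment> \<open>Each \<open>u n\<close> is interior and so bounds the spectral radius; with
    \<open>approximate_eigenvalue_le\<close> this forces \<open>a\<close> to tend to
    \<open>r\<close>.\<close>
  have lower: "r \<le> a n + d n" for n
  proof -
    have "cone_spectral_radius C f \<le> ereal (a n + d n)"
      using s(1,5,8,9) by (intro cone_spectral_radius_le[of "u n"]) (auto intro: add_pos_pos)
    then show ?thesis using r by simp
  qed
  have a: "a \<longlonglongrightarrow> r"
  proof (rule order_tendstoI)
    fix y assume "y < r"
    then have "eventually (\<lambda>n. d n < r - y) sequentially"
      using s(2) by (intro order_tendstoD(2)) auto
    then show "eventually (\<lambda>n. y < a n) sequentially"
      by eventually_elim (use lower in \<open>smt (verit)\<close>)
  next
    fix y assume "r < y"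
    then show "eventually (\<lambda>n. a n < y) sequentially"
      using s r by (intro approximate_eigenvalue_le) (auto intro: less_imp_le)
  qed
  obtain N where N: "0 < N" "\<And>x. x \<in> C \<Longrightarrow> norm x \<le> N * unit_gauge x"
    using norm_le_unit_gauge by blast
  have nu: "norm (u n) \<le> N" for n using N(2)[OF s(3)[of n]] s(4) by simp
  obtain M where M: "0 < M" "\<And>x y. x \<in> C \<Longrightarrow> x \<preceq> y \<Longrightarrow> norm x \<le> M * norm y"
    using normal_bound by blast
  let ?R = "\<lambda>n. \<bar>a n - r\<bar> * N + d n * norm e + M * (d n * N)"
  have bound: "norm (f (u n) - r *\<^sub>R u n) \<le> ?R n" for n
  proof -
    \<comment> \<open>The vector \<open>?w\<close> lies between 0 and
      \<open>d n *\<^sub>R u n\<close>, so normality makes it small.\<close>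
    let ?w = "perturb (d n) (u n) - a n *\<^sub>R u n"
    have "norm ?w \<le> M * norm (d n *\<^sub>R u n)"
      using s(6,7)[of n] by (intro M(2)) (auto simp: cone_le_def algebra_simps)
    also have "\<dots> \<le> M * (d n * N)" using M(1) nu s(1)[of n] by (simp add: abs_of_pos mult_left_mono)
    finally have w: "norm ?w \<le> M * (d n * N)" .
    have eq: "f (u n) - r *\<^sub>R u n = (a n - r) *\<^sub>R u n - d n *\<^sub>R e + ?w"
      using s(4) by (simp add: perturb_def algebra_simps)
    have "norm (f (u n) - r *\<^sub>R u n) \<le> norm ((a n - r) *\<^sub>R u n - d n *\<^sub>R e) + norm ?w"
      unfolding eq by (rule norm_triangle_ineq)
    moreover have "norm ((a n - r) *\<^sub>R u n - d n *\<^sub>R e) \<le> norm ((a n - r) *\<^sub>R u n) + norm (d n *\<^sub>R e)"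
      by (rule norm_triangle_ineq4)
    moreover have "norm ((a n - r) *\<^sub>R u n) \<le> \<bar>a n - r\<bar> * N"
      using nu by (auto intro: mult_left_mono)
    moreover have "norm (d n *\<^sub>R e) = d n * norm e" using s(1)[of n] by simp
    ultimately show ?thesis using w by linarith
  qed
  have "?R \<longlonglongrightarrow> \<bar>r - r\<bar> * N + 0 * norm e + M * (0 * N)"
    by (intro tendsto_intros a s(2))
  then have "?R \<longlonglongrightarrow> 0" by simp
  then have "(\<lambda>n. f (u n) - r *\<^sub>R u n) \<longlonglongrightarrow> 0"
    by (rule Lim_null_comparison[rotated]) (auto intro: always_eventually bound)
  then show thesis using s by (intro that[of u]) auto
qed

text \<open>Writing \<open>r ^ k *\<^sub>R u n\<close> as \<open>(f ^^ k) (u n) + w n\<close> with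
  \<open>w n\<close> tending to 0 gives \<open>r ^ k * \<nu> ?A \<le> c * \<nu> ?A\<close>, and
  \<open>c < r ^ k\<close> leaves only \<open>\<nu> ?A = 0\<close>.\<close>

lemma compact_closure_approximate_eigenvectors:
  assumes \<nu>: "homogeneous_gmnc \<nu>" and c: "gmnc_bound \<nu> C (f ^^ k) c" "c < r ^ k"
    and u: "\<And>n. u n \<in> C" "bounded (range u)" and r: "0 \<le> r"
    and lim: "(\<lambda>n. f (u n) - r *\<^sub>R u n) \<longlonglongrightarrow> 0"
  shows "compact (closure (range u))"
proof -
  have \<nu>_nonneg: "\<forall>A. bounded A \<longrightarrow> 0 \<le> \<nu> A"
    and \<nu>_zero: "\<forall>A. bounded A \<longrightarrow> (\<nu> A = 0 \<longleftrightarrow> compact (closure A))"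
    and \<nu>_plus: "\<forall>A B. bounded A \<longrightarrow> bounded B \<longrightarrow> \<nu> (A + B) \<le> \<nu> A + \<nu> B"
    and \<nu>_scale: "\<forall>A c. bounded A \<longrightarrow> \<nu> ((*\<^sub>R) c ` A) = \<bar>c\<bar> * \<nu> A"
    and \<nu>_mono: "\<forall>A B. bounded A \<longrightarrow> bounded B \<longrightarrow> A \<subseteq> B \<longrightarrow> \<nu> A \<le> \<nu> B"
    using \<nu>[unfolded homogeneous_gmnc_def] by - (elim conjE, assumption)+
  define w where "w n = - ((f ^^ k) (u n) - r ^ k *\<^sub>R u n)" for n
  let ?A = "range u" and ?W = "range w"
  have "w \<longlonglongrightarrow> - 0"
    unfolding w_def by (intro tendsto_minus funpow_approximate_eigenvector[OF u r lim])
  then have w: "w \<longlonglongrightarrow> 0" by simp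
  then have bW: "bounded ?W" by (rule convergent_imp_bounded)
  have "compact (insert 0 ?W)"
    using compactin_sequence_with_limit[of euclidean w 0 ?W] w by simp
  then have cW: "compact (closure ?W)"
    using closure_minimal[of ?W "insert 0 ?W"] compact_imp_closed
    by (metis closed_closure compact_Int_closed inf.absorb_iff2 subset_insertI)
  have fA: "bounded ((f ^^ k) ` ?A)" "\<nu> ((f ^^ k) ` ?A) \<le> c * \<nu> ?A"
    using c(1) u unfolding gmnc_bound_def by blast+
  have sub: "(*\<^sub>R) (r ^ k) ` ?A \<subseteq> (f ^^ k) ` ?A + ?W"
  proof safe
    fix n
    have "r ^ k *\<^sub>R u n = (f ^^ k) (u n) + w n" by (simp add: w_def)
    then show "r ^ k *\<^sub>R u n \<in> (f ^^ k) ` ?A + ?W" by (auto intro: set_plus_intro)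
  qed
  have bS: "bounded ((f ^^ k) ` ?A + ?W)" 
    by (rule bounded_subset[OF bounded_sums[OF fA(1) bW]]) (auto simp: set_plus_def)
  have "\<bar>r ^ k\<bar> * \<nu> ?A = \<nu> ((*\<^sub>R) (r ^ k) ` ?A)"
    using \<nu>_scale u(2) by simp
  also have "\<dots> \<le> \<nu> ((f ^^ k) ` ?A + ?W)"
    using \<nu>_mono[rule_format, OF bounded_scaling[OF u(2)] bS sub] .
  also have "\<dots> \<le> \<nu> ((f ^^ k) ` ?A) + \<nu> ?W"
    using \<nu>_plus[rule_format, OF fA(1) bW] .
  also have "\<nu> ?W = 0" using \<nu>_zero bW cW by simp
  finally have "(r ^ k - c) * \<nu> ?A \<le> 0" using fA(2) r by (simp add: algebra_simps)
  moreover have "0 \<le> \<nu> ?A" using \<nu>_nonneg u(2) by simp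
  ultimately have "\<nu> ?A = 0" using c(2) by (simp add: mult_le_0_iff)
  then show ?thesis using \<nu>_zero u(2) by simp
qed

lemma eigenvector_of_ess_spectral_radius_less:
  assumes \<nu>: "homogeneous_gmnc \<nu>"
    and less: "cone_ess_spectral_radius \<nu> C f < ereal r"
    and r: "cone_spectral_radius C f = ereal r"
  obtains v where "v \<in> C" "v \<noteq> 0" "f v = r *\<^sub>R v"
proof -
  have r0: "0 \<le> r" using cone_spectral_radius_nonneg by (simp add: r)
  obtain k where k: "1 \<le> k" "ereal_root k (cone_gmnc \<nu> C (f ^^ k)) < ereal r"
    using less unfolding cone_ess_spectral_radius_def by (auto simp: INF_less_iff)
  \<comment> \<open>The value is finite: the strict bound excludes \<open>\<infinity>\<close>,
    nonnegativity excludes \<open>-\<infinity>\<close>.\<close>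
  obtain g where g: "cone_gmnc \<nu> C (f ^^ k) = ereal g"
    using k(2) cone_gmnc_nonneg[of \<nu> C "f ^^ k"] by (cases "cone_gmnc \<nu> C (f ^^ k)") auto
  have g0: "0 \<le> g" using cone_gmnc_nonneg[of \<nu> C "f ^^ k"] g by simp
  have "root k g ^ k < r ^ k"
    using k g g0 by (intro power_strict_mono) auto
  then have "cone_gmnc \<nu> C (f ^^ k) < ereal (r ^ k)" using k g g0 by simp
  then obtain c where c: "gmnc_bound \<nu> C (f ^^ k) c" "c < r ^ k"
    unfolding cone_gmnc_less_iff by auto
  obtain u where u: "\<And>n. u n \<in> C" "\<And>n. unit_gauge (u n) = 1" "(\<lambda>n. f (u n) - r *\<^sub>R u n) \<longlonglongrightarrow> 0"
    using approximate_eigenvector_residual[OF r] by metis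
  obtain N where N: "0 < N" "\<And>x. x \<in> C \<Longrightarrow> norm x \<le> N * unit_gauge x"
    using norm_le_unit_gauge by blast
  have "bounded (range u)"
    using N(2)[OF u(1)] u(2) by (auto simp: bounded_iff)
  then have "compact (closure (range u))"
    using compact_closure_approximate_eigenvectors[OF \<nu> c u(1) _ r0 u(3)] by simp
  then have "seq_compact (closure (range u))" by (simp add: compact_eq_seq_compact_metric)
  then obtain v s where v: "strict_mono (s :: nat \<Rightarrow> nat)" "(u \<circ> s) \<longlonglongrightarrow> v"
    by (metis closure_subset range_subsetD seq_compactE)
  have vC: "v \<in> C"
    by (rule closed_sequentially[OF closed_C _ v(2)]) (simp add: u(1))
  have us: "(\<lambda>n. u (s n)) \<longlonglongrightarrow> v" using v(2) by (simp add: comp_def)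
  have "(\<lambda>n. f (u (s n)) - r *\<^sub>R u (s n)) \<longlonglongrightarrow> f v - r *\<^sub>R v"
    by (intro tendsto_intros map_tendsto us vC u(1))
  moreover have "(\<lambda>n. f (u (s n)) - r *\<^sub>R u (s n)) \<longlonglongrightarrow> 0"
    using LIMSEQ_subseq_LIMSEQ[OF u(3) v(1)] by (simp add: comp_def)
  ultimately have "f v - r *\<^sub>R v = 0" by (rule LIMSEQ_unique)
  \<comment> \<open>Gauge 1 keeps the norms of \<open>u n\<close> at least \<open>1 / L\<close>, and
    this passes to the limit.\<close>
  moreover have "v \<noteq> 0"
  proof -
    obtain L where L: "0 < L" "\<And>x. unit_gauge x \<le> L * norm x" using unit_gauge_le_norm by blast
    have "1 \<le> L * norm (u (s n))" for n using L(2)[of "u (s n)"] u(2) by simp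
    moreover have "(\<lambda>n. L * norm (u (s n))) \<longlonglongrightarrow> L * norm v"
      by (intro tendsto_intros us)
    ultimately have "1 \<le> L * norm v" by (meson LIMSEQ_le_const)
    then show ?thesis by auto
  qed
  ultimately show thesis using vC by (intro that[of v]) auto
qed

lemma cone_spectral_radius_finite:
  obtains r where "0 \<le> r" "cone_spectral_radius C f = ereal r"
proof -
  obtain u a d where "u \<in> interior C" "f u \<preceq> (a + d) *\<^sub>R u" "0 < a" "0 < (d::real)"
    using approximate_eigenvector_sequence by metis
  then have "cone_spectral_radius C f \<le> ereal (a + d)"
    by (intro cone_spectral_radius_le) auto
  then show thesis
    using cone_spectral_radius_nonneg that by (cases "cone_spectral_radius C f") auto
qed

end

section \<open>Both formulas, with the zero space treated separately\<close>

theorem theorem1p1: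
  fixes C :: "'a::banach set" and f :: "'a \<Rightarrow> 'a"
  assumes "normal_cone C"
    and "interior C \<noteq> {}"
    and "f ` C \<subseteq> C"
    and "pos_homogeneous_on C f"
    and "order_preserving_on C f"
    and "\<And>B. B \<subseteq> C \<Longrightarrow> bounded B \<Longrightarrow> uniformly_continuous_on B f"
  shows "cone_spectral_radius C f =
           Inf (ereal ` {c. c > 0 \<and> (\<exists>u\<in>interior C. cone_le C (f u) (c *\<^sub>R u))}) \<and>
         (\<forall>\<nu>. homogeneous_gmnc \<nu> \<longrightarrow>
            cone_ess_spectral_radius \<nu> C f < cone_spectral_radius C f \<longrightarrow>
            (\<exists>m. is_maximum {\<mu>. \<mu> \<ge> 0 \<and> (\<exists>v\<in>C - {0}. f v = \<mu> *\<^sub>R v)} m \<and>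
                 cone_spectral_radius C f = ereal m))"
proof -
  interpret monotone_map C f using assms by unfold_locales
  show ?thesis
  proof (cases "\<exists>e\<in>interior C. e \<noteq> 0")
    case True
    then obtain e where e: "e \<in> interior C" "e \<noteq> 0" by blast
    interpret uniformly_continuous_map C e f using assms e by unfold_locales
    obtain r where r: "0 \<le> r" "cone_spectral_radius C f = ereal r"
      using cone_spectral_radius_finite .
    show ?thesis
    proof (intro conjI allI impI cone_spectral_radius_eq_Inf exI[of _ r] r(2))
      fix \<nu> :: "'a set \<Rightarrow> real"
      assume "homogeneous_gmnc \<nu>" "cone_ess_spectral_radius \<nu> C f < cone_spectral_radius C f"
      then obtain v where v: "v \<in> C" "v \<noteq> 0" "f v = r *\<^sub>R v"
        using eigenvector_of_ess_spectral_radius_less r(2) by metis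
      show "is_maximum {\<mu>. \<mu> \<ge> 0 \<and> (\<exists>v\<in>C - {0}. f v = \<mu> *\<^sub>R v)} r"
        using v r eigenvalue_le_cone_spectral_radius unfolding is_maximum_def by fastforce
    qed
  next
    case False
    then have zero: "0 \<in> interior C" using assms(2) by auto
    \<comment> \<open>If 0 is interior, every vector lies below 0. Applied to \<open>x\<close> and
      \<open>- x\<close>, pointedness collapses the space.\<close>
    have trivial: "x = 0" for x :: 'a
    proof -
      obtain L where "\<And>x. x \<preceq> (L * norm x) *\<^sub>R (0::'a)" using interior_dominates[OF zero] by blast
      from this[of x] this[of "- x"] show ?thesis
        by (intro mem_uminus_eq_0) (auto simp: cone_le_def)
    qed
    have S: "{c. c > 0 \<and> (\<exists>u\<in>interior C. f u \<preceq> c *\<^sub>R u)} = {0<..}"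
      using zero by (auto simp: trivial[of "f _"] trivial[of "_ *\<^sub>R _"] ord_refl)
    have small: "cone_spectral_radius C f \<le> ereal c" if "0 < c" for c
      using cone_spectral_radius_le[OF zero _ that] trivial ord_refl by metis
    have r: "cone_spectral_radius C f = 0"
      by (rule antisym[OF ereal_le_epsilon2 cone_spectral_radius_nonneg]) (simp add: small)
    have "Inf (ereal ` {0<..}) = 0"
    proof (rule antisym)
      show "Inf (ereal ` {0<..}) \<le> 0"
        by (rule ereal_le_epsilon2) (auto intro!: Inf_lower)
    qed (auto intro: Inf_greatest)
    \<comment> \<open>Here the spectral radius is 0, so the strict inequality assumed for the
      maximum formula cannot hold.\<close>
    moreover have "0 \<le> cone_ess_spectral_radius \<nu> C f" for \<nu>
      unfolding cone_ess_spectral_radius_def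
    proof (rule INF_greatest)
      fix k :: nat assume "k \<in> {1..}"
      then have "ereal_root k 0 \<le> ereal_root k (cone_gmnc \<nu> C (f ^^ k))"
        by (intro ereal_root_mono cone_gmnc_nonneg) auto
      then show "0 \<le> ereal_root k (cone_gmnc \<nu> C (f ^^ k))" by (simp add: zero_ereal_def)
    qed
    ultimately show ?thesis using r S by (auto simp: not_less[symmetric])
  qed
qed

end
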